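(* For every integer $p\geq 0$, $$\sum_{n=0}^{p} n\,D(n)=\left\lfloor \frac{(p+1)!}{e}\right\rfloor,$$ where $D(n)$ denotes the number of derangements of $\{1,2,\dots,n\}$.
   Context: A derangement of $\{1,2,\dots,n\}$ is a permutation of this set with no fixed points; $D(n)$ is the number of such derangements, so that $D(n)=n!\sum_{i=0}^{n}\frac{(-1)^i}{i!}$ (in particular $D(0)=1$, $D(1)=0$, $D(2)=1$). Here $\lfloor x\rfloor$ denotes the integer part (floor) of a real number $x$, and $e$ is Euler's number. *)

theory Defs
  imports Complex_Main "HOL-Combinatorics.Permutations"
begin

definition derangements :: "nat \<Rightarrow> (nat \<Rightarrow> nat) set" where
  "derangements n = {\<pi>. \<pi> permutes {1..n} \<and> (\<forall>i\<in>{1..n}. \<pi> i \<noteq> i)}"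

definition D :: "nat \<Rightarrow> nat" where
  "D n = card (derangements n)"

end

theory Submission
  imports Defs
begin

text \<open>
  Sorting the permutations of a finite set by their set of moved points and applying Moebius
  inversion gives the classical formula for \<open>D n\<close>, hence \<open>D (n + 1) = (n + 1) D n + (-1)^(n + 1)\<close>.
  The recurrence makes the sum telescope to \<open>D (p + 1)\<close>, minus \<open>1\<close> if \<open>p\<close> is odd.
  By the Leibniz criterion for the series of \<open>exp (-1)\<close>, this is the integer part of
  \<open>(p + 1)! / e\<close>: the tail omitted from \<open>D (p + 1)\<close> is less than \<open>1\<close> in absolute value,
  and it is negative exactly for odd \<open>p\<close>.
\<close>

lemma fact_card_eq_sum_derangements:
  assumes "finite S"
  shows "fact (card S) =
    (\<Sum>T\<in>Pow S. card {\<pi>. \<pi> permutes T \<and> (\<forall>i\<in>T. \<pi> i \<noteq> i)})"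
proof -
  let ?d = "\<lambda>T. {\<pi>. \<pi> permutes T \<and> (\<forall>i\<in>T. \<pi> i \<noteq> i)}"
  have "{\<pi>. \<pi> permutes S} = (\<Union>T\<in>Pow S. ?d T)"
  proof (intro equalityI subsetI)
    fix \<pi> assume "\<pi> \<in> {\<pi>. \<pi> permutes S}"
    then have "\<pi> permutes S" by simp
    then have "\<pi> permutes {i \<in> S. \<pi> i \<noteq> i}"
      by (rule permutes_superset) auto
    then show "\<pi> \<in> (\<Union>T\<in>Pow S. ?d T)" by fastforce
  qed (auto intro: permutes_subset)
  \<comment> \<open>A point lying in just one of \<open>T\<close> and \<open>U\<close> is moved by
    every member of one family and fixed by every member of the other.\<close>
  moreover have "\<forall>T\<in>Pow S. \<forall>U\<in>Pow S. T \<noteq> U \<longrightarrow> ?d T \<inter> ?d U = {}"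
    by (auto dest: permutes_not_in)
  moreover have "\<forall>T\<in>Pow S. finite (?d T)"
  proof
    fix T assume "T \<in> Pow S"
    then have "finite {\<pi>. \<pi> permutes T}"
      using assms by (auto intro: finite_permutations finite_subset)
    then show "finite (?d T)" by (rule rev_finite_subset) auto
  qed
  ultimately have "card {\<pi>. \<pi> permutes S} = (\<Sum>T\<in>Pow S. card (?d T))"
    using assms card_UN_disjoint[of "Pow S" ?d] by simp
  then show ?thesis
    using assms by (simp add: card_permutations)
qed

lemma sum_Pow_card:
  fixes h :: "nat \<Rightarrow> 'b::semiring_1"
  assumes "finite S"
  shows "(\<Sum>T\<in>Pow S. h (card T)) = (\<Sum>k\<le>card S. of_nat (card S choose k) * h k)"
proof -
  have "(\<Sum>T\<in>Pow S. h (card T)) = (\<Sum>k\<le>card S. \<Sum>T | T \<in> Pow S \<and> card T = k. h (card T))"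
    using assms by (intro sum.group[symmetric]) (auto intro: card_mono)
  also have "\<dots> = (\<Sum>k\<le>card S. of_nat (card S choose k) * h k)"
    using assms by (intro sum.cong) (auto simp: n_subsets)
  finally show ?thesis .
qed

lemma D_eq: "real (D n) = fact n * (\<Sum>i\<le>n. (-1) ^ i / fact i)"
proof -
  let ?d = "\<lambda>T::nat set. real (card {\<pi>. \<pi> permutes T \<and> (\<forall>i\<in>T. \<pi> i \<noteq> i)})"
  have "real (D n) = ?d {1..n}"
    by (simp add: D_def derangements_def)
  also have "\<dots> = (\<Sum>T\<in>Pow {1..n}. (-1) ^ (card {1..n} - card T) * fact (card T))"
  \<comment> \<open>The inversion needs the subset-sum identity for every finite set of naturals,
    not only for \<open>{1..n}\<close>, so \<open>?d\<close> is defined on all sets.\<close>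
  proof (rule inclusion_exclusion_mobius)
    fix S :: "nat set" assume "finite S"
    then have "real (fact (card S)) = sum ?d (Pow S)"
      by (simp only: fact_card_eq_sum_derangements of_nat_sum)
    then show "fact (card S) = sum ?d (Pow S)" by simp
  qed simp
  also have "\<dots> = (\<Sum>k\<le>n. real (n choose k) * ((-1) ^ (n - k) * fact k))"
    using sum_Pow_card[of "{1..n}" "\<lambda>k. (-1) ^ (n - k) * fact k :: real"] by simp
  also have "\<dots> = (\<Sum>k\<le>n. fact n * ((-1) ^ (n - k) / fact (n - k)))"
    by (intro sum.cong) (simp_all add: binomial_fact)
  also have "\<dots> = (\<Sum>i\<le>n. fact n * ((-1) ^ i / fact i))"
    by (rule sum.reindex_bij_witness[of _ "\<lambda>i. n - i" "\<lambda>i. n - i"]) auto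
  finally show ?thesis by (simp add: sum_distrib_left)
qed

lemma D_Suc: "int (D (Suc n)) = int (Suc n) * int (D n) + (-1) ^ Suc n"
proof -
  have "real (D (Suc n)) = real (Suc n) * real (D n) + (-1) ^ Suc n"
  proof -
    have "fact (Suc n) * (x + y / fact (Suc n)) = real (Suc n) * (fact n * x) + y" for x y :: real
      by (simp add: distrib_left del: fact_Suc) simp
    then show ?thesis by (simp only: D_eq sum.atMost_Suc)
  qed
  then have "real_of_int (int (D (Suc n))) = real_of_int (int (Suc n) * int (D n) + (-1) ^ Suc n)"
    by simp
  then show ?thesis by (simp only: of_int_eq_iff)
qed

text \<open>By \<open>D_Suc\<close>, n D(n) = D(n+1) - D(n) + (-1)^n. Telescoping leaves D(p+1) -
  D(0), and the signs add up to 1 for even p and to 0 for odd p, where D(0) = 1.\<close>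

lemma sum_mult_D: "int (\<Sum>n=0..p. n * D n) = int (D (Suc p)) - (if even p then 0 else 1)"
proof (induction p)
  case 0
  show ?case using D_Suc[of 0] D_eq[of 0] by simp
next
  case (Suc p)
  then show ?case using D_Suc[of "Suc p"] by (cases "even p") (simp_all add: algebra_simps)
qed

lemma exp_minus_one_partial_sums:
  shows "(\<Sum>i<2*n. (-1) ^ i / fact i) \<le> exp (-1 :: real)"
    and "exp (-1 :: real) \<le> (\<Sum>i<2*n+1. (-1) ^ i / fact i)"
proof -
  have lim: "(\<lambda>i. 1 / fact i :: real) \<longlonglongrightarrow> 0"
    using summable_LIMSEQ_zero[OF summable_exp[of "1::real"]] by (simp add: field_simps)
  have mono: "1 / fact (Suc i) \<le> (1 / fact i :: real)" for i
    by (intro divide_left_mono fact_mono) auto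
  have "(\<Sum>i. (-1) ^ i * (1 / fact i)) = exp (-1 :: real)"
    by (simp add: exp_def divide_inverse mult.commute)
  then show "(\<Sum>i<2*n. (-1) ^ i / fact i) \<le> exp (-1 :: real)"
    "exp (-1 :: real) \<le> (\<Sum>i<2*n+1. (-1) ^ i / fact i)"
    using summable_Leibniz'(2,4)[OF lim _ mono, of n] by simp_all
qed

theorem theorem1:
  fixes p :: nat
  shows "int (\<Sum>n=0..p. n * D n) = \<lfloor>fact (p + 1) / exp 1 :: real\<rfloor>"
proof -
  \<comment> \<open>\<open>S n\<close> has n terms, the last of index n - 1, so D(p+1) corresponds
    to \<open>S (p + 2)\<close>.\<close>
  define S :: "nat \<Rightarrow> real" where "S n = (\<Sum>i<n. (-1) ^ i / fact i)" for n
  define F :: real where "F = fact (p + 1)"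
  have F: "F > 0" by (simp add: F_def)
  have D: "real (D (Suc p)) = F * S (p + 2)"
    by (simp add: D_eq S_def F_def lessThan_Suc_atMost)
  have e: "F / exp 1 = F * exp (-1)"
    by (simp add: exp_minus divide_inverse)
  \<comment> \<open>The first omitted term has index p + 2; multiplied by (p+1)! it is (-1)^p /
    (p+2), so r = 1/(p+2). Only r < 1 matters below.\<close>
  obtain r where S3: "F * S (p + 3) = F * S (p + 2) + (-1) ^ p * r" and small: "r < 1"
  proof
    show "F * S (p + 3) = F * S (p + 2) + (-1) ^ p * (1 / real (p + 2))"
      by (simp add: S_def F_def numeral_3_eq_3 distrib_left)
  qed simp
  have "\<lfloor>F / exp 1\<rfloor> = int (D (Suc p)) - (if even p then 0 else 1)"
  proof (cases "even p")
    case True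
    then obtain m where m: "p + 2 = 2 * m" by (metis dvd_def even_add even_numeral)
    then have m': "p + 3 = 2 * m + 1" by simp
    then have "F * S (p + 2) \<le> F * exp (-1)" "F * exp (-1) \<le> F * S (p + 3)"
      using exp_minus_one_partial_sums[of m] F unfolding m m' S_def by simp_all
    then show ?thesis
      using True e D S3 small by (intro floor_unique) auto
  next
    case False
    then obtain m where m: "p + 3 = 2 * m" by (metis dvd_def even_add odd_numeral)
    \<comment> \<open>The floor is D(p+1) - 1 only if F/e is strictly below D(p+1), but the Leibniz
      bounds are not strict. Hence the upper bound is taken two terms later: for odd p these terms,
      -1/(p+2)! and 1/(p+3)!, have negative sum.\<close>
    have "S (2 * m + 1) < S (p + 2)"
    proof -
      have "2 * m + 1 = Suc (Suc (p + 2))" using m by simp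
      moreover have "1 / fact (p + 3) < (1 / fact (p + 2) :: real)"
        by (intro divide_strict_left_mono fact_less_mono) auto
      ultimately show ?thesis using False by (simp add: S_def eval_nat_numeral)
    qed
    then have "F * S (p + 3) \<le> F * exp (-1)" "F * exp (-1) < F * S (p + 2)"
      using exp_minus_one_partial_sums[of m] F m by (simp_all add: S_def)
    then show ?thesis
      using False e D S3 small by (intro floor_unique) auto
  qed
  then show ?thesis
    unfolding F_def sum_mult_D by simp
qed

end
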